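(* Let $r=(r_1,\dots,r_n)$ be an $n$-tuple of positive real numbers, let $p\ge 0$, and let $f:\mathbb{R}^n\to\mathbb{R}^n$ be a vector field that is homogeneous of degree $p$ with respect to the dilation map $\delta_\lambda^r$. Let $\overline f$ be the transformed function associated with $f$ and $r$. Then $\overline f$ is homogeneous of degree $p$ with respect to the standard dilation map, i.e. $\overline f(\lambda z)=\lambda^{p}\,\lambda\,\overline f(z)=\lambda^{p+1}\overline f(z)$ for all $\lambda>0$ and all $z\in\mathbb{R}^n_+$.
   Context: $\mathbb{R}^n_+$ denotes the nonnegative orthant of $\mathbb{R}^n$. For an $n$-tuple $r=(r_1,\dots,r_n)$ of positive reals and $\lambda>0$, the dilation map is $\delta_\lambda^r(x)=(\lambda^{r_1}x_1,\dots,\lambda^{r_n}x_n)$; for $r=(1,\dots,1)$ it is called the standard dilation map. A vector field $f$ is homogeneous of degree $p\ge 0$ with respect to $\delta_\lambda^r$ if $f(\delta_\lambda^r(x))=\lambda^p\delta_\lambda^r(f(x))$ for all $x$ and all $\lambda>0$, i.e. $f_i(\delta_\lambda^r(x))=\lambda^{p+r_i}f_i(x)$ for each $i$. Transformed function: with the change of variables $z_i=x_i^{1/r_i}$ (i.e. $x_i=z_i^{r_i}$), define for $z\in\mathbb{R}^n_+$ and $i=1,\dots,n$ $$\overline f_i(z)=\frac{f_i(z_1^{r_1},\dots,z_n^{r_n})}{z_i^{r_i-1}}\ \text{ if } z_i\neq 0,\qquad \overline f_i(z)=0\ \text{ if } z_i=0.$$ *)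

theory Defs
  imports "HOL-Analysis.Analysis"
begin

definition nonneg_orthant :: "(real ^ 'n) set" where
  "nonneg_orthant = {x. \<forall>i. 0 \<le> x $ i}"

definition dilation :: "real ^ 'n \<Rightarrow> real \<Rightarrow> real ^ 'n \<Rightarrow> real ^ 'n" where
  "dilation r c x = (\<chi> i. c powr (r $ i) * x $ i)"

abbreviation standard_weights :: "real ^ 'n" where
  "standard_weights \<equiv> (\<chi> i. 1)"

text \<open>The set \<open>S\<close> is the domain of the vector field; it is meant to be invariant under
  the dilations (\<open>UNIV\<close> or the nonnegative orthant).\<close>

definition homogeneous_on ::
    "(real ^ 'n) set \<Rightarrow> real ^ 'n \<Rightarrow> real \<Rightarrow> (real ^ 'n \<Rightarrow> real ^ 'n) \<Rightarrow> bool" where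
  "homogeneous_on S r p f \<longleftrightarrow>
     (\<forall>x\<in>S. \<forall>c>0. f (dilation r c x) = (c powr p) *\<^sub>R dilation r c (f x))"

text \<open>Only the values on the nonnegative orthant are meaningful. There, \<open>0 powr a = 0\<close> agrees
  with the usual power because the weights are positive, and the powers in the denominator have
  a positive base.\<close>

definition transformed ::
    "real ^ 'n \<Rightarrow> (real ^ 'n \<Rightarrow> real ^ 'n) \<Rightarrow> real ^ 'n \<Rightarrow> real ^ 'n" where
  "transformed r f z =
     (\<chi> i. if z $ i \<noteq> 0
           then f (\<chi> j. (z $ j) powr (r $ j)) $ i / (z $ i) powr (r $ i - 1)
           else 0)"

end

theory Submission
  imports Defs
begin

text \<open>
  The substitution \<open>x\<^sub>i = z\<^sub>i powr r\<^sub>i\<close> carries the standard dilation of the orthant to the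
  weighted one (\<open>coordinatewise_powr_scaleR\<close>). Hence scaling \<open>z\<close> by \<open>c\<close> multiplies the numerator
  \<open>f\<^sub>i\<close> of the transformed function by \<open>c powr (p + r\<^sub>i)\<close>. The denominator \<open>z\<^sub>i powr (r\<^sub>i - 1)\<close>
  contributes \<open>c powr (r\<^sub>i - 1)\<close>, so the weight \<open>r\<^sub>i\<close> cancels and every component is left with the
  same factor \<open>c powr (p + 1)\<close>. Coordinates with \<open>z\<^sub>i = 0\<close> keep the value \<open>0\<close>, because scaling by
  \<open>c > 0\<close> does not change which coordinates vanish.
\<close>

lemma dilation_standard_weights:
  assumes "c > 0"
  shows "dilation standard_weights c x = c *\<^sub>R x"
  using assms by (simp add: dilation_def vec_eq_iff)

lemma coordinatewise_powr_scaleR: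
  fixes r z :: "real ^ 'n"
  assumes "c > 0" and "z \<in> nonneg_orthant"
  shows "(\<chi> j. ((c *\<^sub>R z) $ j) powr (r $ j)) = dilation r c (\<chi> j. (z $ j) powr (r $ j))"
  using assms by (simp add: dilation_def nonneg_orthant_def vec_eq_iff powr_mult)

text \<open>
  Homogeneity of \<open>f\<close> is applied at the point with coordinates \<open>z\<^sub>i powr r\<^sub>i\<close>, which lies in the
  orthant; the identity then reduces to \<open>p + r\<^sub>i = (p + 1) + (r\<^sub>i - 1)\<close> in the exponents of \<open>c\<close>.
\<close>

lemma transformed_scaleR:
  fixes r z :: "real ^ 'n"
  assumes hom: "homogeneous_on nonneg_orthant r p f"
    and c: "c > 0" and z: "z \<in> nonneg_orthant"
  shows "transformed r f (c *\<^sub>R z) = (c powr (p + 1)) *\<^sub>R transformed r f z"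
proof (subst vec_eq_iff, rule allI)
  fix i
  define x :: "real ^ 'n" where "x = (\<chi> j. (z $ j) powr (r $ j))"
  have "x \<in> nonneg_orthant"
    by (simp add: x_def nonneg_orthant_def)
  with hom c have "f (dilation r c x) = (c powr p) *\<^sub>R dilation r c (f x)"
    by (simp add: homogeneous_on_def)
  then have numerator: "f (dilation r c x) $ i = c powr p * (c powr (r $ i) * f x $ i)"
    by (simp add: dilation_def)
  have denominator: "(c * z $ i) powr (r $ i - 1) = c powr (r $ i - 1) * (z $ i) powr (r $ i - 1)"
    using c z by (simp add: nonneg_orthant_def powr_mult)
  have exponents: "c powr p * c powr (r $ i) = c powr (p + 1) * c powr (r $ i - 1)"
    by (simp flip: powr_add)
  show "transformed r f (c *\<^sub>R z) $ i = ((c powr (p + 1)) *\<^sub>R transformed r f z) $ i"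
  proof (cases "z $ i = 0")
    case True
    then show ?thesis
      by (simp add: transformed_def)
  next
    case False
    have "transformed r f (c *\<^sub>R z) $ i = f (dilation r c x) $ i / (c * z $ i) powr (r $ i - 1)"
      using False c coordinatewise_powr_scaleR[OF c z, of r]
      by (simp add: transformed_def x_def)
    also have "\<dots> = (c powr (p + 1) * c powr (r $ i - 1)) * f x $ i
        / (c powr (r $ i - 1) * (z $ i) powr (r $ i - 1))"
      by (simp only: numerator denominator exponents flip: mult.assoc)
    also have "\<dots> = c powr (p + 1) * (f x $ i / (z $ i) powr (r $ i - 1))"
      using c by simp
    also have "\<dots> = ((c powr (p + 1)) *\<^sub>R transformed r f z) $ i"
      using False by (simp add: transformed_def x_def)
    finally show ?thesis .
  qed
qed

theorem lemma1:
  fixes r :: "real ^ 'n" and p :: real and f :: "real ^ 'n \<Rightarrow> real ^ 'n"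
  assumes "\<forall>i. r $ i > 0"
    and "p \<ge> 0"
    and "homogeneous_on UNIV r p f"
  shows "homogeneous_on nonneg_orthant standard_weights p (transformed r f) \<and>
    (\<forall>c>0. \<forall>z\<in>nonneg_orthant.
       transformed r f (c *\<^sub>R z) = (c powr p * c) *\<^sub>R transformed r f z \<and>
       transformed r f (c *\<^sub>R z) = (c powr (p + 1)) *\<^sub>R transformed r f z)"
proof -
  have "homogeneous_on nonneg_orthant r p f"
    using assms(3) by (simp add: homogeneous_on_def)
  note scale = transformed_scaleR[OF this]
  have "c powr (p + 1) = c powr p * c" if "c > 0" for c :: real
    using that by (simp add: powr_add)
  with scale show ?thesis
    by (simp add: homogeneous_on_def dilation_standard_weights)
qed

end
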